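(* Let $S$ be a quandle and $T$ a 2-reductive medial quandle. Then $\mathrm{Hom}(S,T)$ embeds as a quandle in $T^{c(S)}$, and under this embedding $\mathrm{Hom}(S,T)=\bigcup_i X_i$ where each $X_i$ is a component of $T^{c(S)}$. That is, there is an injective quandle homomorphism $\mathrm{Hom}(S,T)\to T^{c(S)}$ whose image is a union of components of $T^{c(S)}$.
   Context: A quandle is a set $Q$ with a binary operation $\triangleright$ such that $x\triangleright x=x$; for all $y,z$ there is a unique $x$ with $y\triangleright x=z$; and $x\triangleright(y\triangleright z)=(x\triangleright y)\triangleright(x\triangleright z)$. It is medial if $(x\triangleright y)\triangleright(z\triangleright w)=(x\triangleright z)\triangleright(y\triangleright w)$, and 2-reductive if $(x\triangleright y)\triangleright z=y\triangleright z$, for all elements (2-reductive in this sense implies medial). The components of $Q$ are the orbits of the group generated by the bijections $L_a:x\mapsto a\triangleright x$; $c(Q)$ is the set of components. $T^{c(S)}$ is the direct power of $T$ indexed by the set $c(S)$, with coordinatewise operation. For $T$ medial, $\mathrm{Hom}(S,T)$, the set of quandle homomorphisms, is a (medial) quandle under the pointwise operation $(h\triangleright k)(a)=h(a)\triangleright k(a)$ (known). *)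

theory Defs
  imports "HOL-Algebra.Group_Action" "HOL-Algebra.Generated_Groups" "HOL-Algebra.Bij"
begin

record 'a quandle_struct = "'a partial_object" +
  tri :: "['a, 'a] \<Rightarrow> 'a"  (infix \<open>\<triangleright>\<index>\<close> 70)

text \<open>The empty carrier is allowed.\<close>

locale quandle =
  fixes Q (structure)
  assumes tri_closed [intro, simp]:
      "\<lbrakk>x \<in> carrier Q; y \<in> carrier Q\<rbrakk> \<Longrightarrow> x \<triangleright> y \<in> carrier Q"
    and tri_idem: "x \<in> carrier Q \<Longrightarrow> x \<triangleright> x = x"
    and tri_unique_solution:
      "\<lbrakk>y \<in> carrier Q; z \<in> carrier Q\<rbrakk> \<Longrightarrow> \<exists>!x. x \<in> carrier Q \<and> y \<triangleright> x = z"
    and tri_self_distrib: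
      "\<lbrakk>x \<in> carrier Q; y \<in> carrier Q; z \<in> carrier Q\<rbrakk>
        \<Longrightarrow> x \<triangleright> (y \<triangleright> z) = (x \<triangleright> y) \<triangleright> (x \<triangleright> z)"

locale medial_quandle = quandle +
  assumes medial:
    "\<lbrakk>x \<in> carrier Q; y \<in> carrier Q; z \<in> carrier Q; w \<in> carrier Q\<rbrakk>
      \<Longrightarrow> (x \<triangleright> y) \<triangleright> (z \<triangleright> w) = (x \<triangleright> z) \<triangleright> (y \<triangleright> w)"

locale two_reductive_medial_quandle = medial_quandle +
  assumes two_reductive:
    "\<lbrakk>x \<in> carrier Q; y \<in> carrier Q; z \<in> carrier Q\<rbrakk>
      \<Longrightarrow> (x \<triangleright> y) \<triangleright> z = y \<triangleright> z"

definition left_translation :: "('a, 'b) quandle_struct_scheme \<Rightarrow> 'a \<Rightarrow> 'a \<Rightarrow> 'a"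
  where "left_translation Q a = (\<lambda>x\<in>carrier Q. a \<triangleright>\<^bsub>Q\<^esub> x)"

definition translation_group :: "('a, 'b) quandle_struct_scheme \<Rightarrow> ('a \<Rightarrow> 'a) monoid"
  where "translation_group Q =
    subgroup_generated (BijGroup (carrier Q)) (left_translation Q ` carrier Q)"

definition components :: "('a, 'b) quandle_struct_scheme \<Rightarrow> 'a set set"
  where "components Q = orbits (translation_group Q) (carrier Q) (\<lambda>g. g)"

text \<open>Homomorphisms are taken extensional (\<open>undefined\<close> off the carrier of the source), so that
  distinct elements are distinct as maps on the carrier.\<close>

definition quandle_hom ::
    "('a, 'c) quandle_struct_scheme \<Rightarrow> ('b, 'd) quandle_struct_scheme \<Rightarrow> ('a \<Rightarrow> 'b) set"
  where "quandle_hom S T =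
    {h \<in> carrier S \<rightarrow>\<^sub>E carrier T.
      \<forall>x\<in>carrier S. \<forall>y\<in>carrier S. h (x \<triangleright>\<^bsub>S\<^esub> y) = h x \<triangleright>\<^bsub>T\<^esub> h y}"

definition Hom_quandle ::
    "('a, 'c) quandle_struct_scheme \<Rightarrow> ('b, 'd) quandle_struct_scheme \<Rightarrow> ('a \<Rightarrow> 'b) quandle_struct"
  where "Hom_quandle S T =
    \<lparr>carrier = quandle_hom S T, tri = (\<lambda>h k. \<lambda>a\<in>carrier S. h a \<triangleright>\<^bsub>T\<^esub> k a)\<rparr>"

definition power_quandle ::
    "('b, 'd) quandle_struct_scheme \<Rightarrow> 'i set \<Rightarrow> ('i \<Rightarrow> 'b) quandle_struct"
  where "power_quandle T I =
    \<lparr>carrier = I \<rightarrow>\<^sub>E carrier T, tri = (\<lambda>f g. \<lambda>i\<in>I. f i \<triangleright>\<^bsub>T\<^esub> g i)\<rparr>"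

lemma (in quandle) left_translation_Bij:
  assumes "a \<in> carrier Q"
  shows "left_translation Q a \<in> Bij (carrier Q)"
proof -
  have "bij_betw (\<lambda>x. a \<triangleright> x) (carrier Q) (carrier Q)"
    unfolding bij_betw_def inj_on_def
  proof (intro conjI ballI impI)
    fix x y assume "x \<in> carrier Q" "y \<in> carrier Q" "a \<triangleright> x = a \<triangleright> y"
    then show "x = y" using tri_unique_solution[OF assms, of "a \<triangleright> y"] assms by blast
  next
    show "(\<triangleright>) a ` carrier Q = carrier Q"
      using tri_unique_solution[OF assms] assms by (auto simp: image_iff) metis
  qed
  then show ?thesis
    by (simp add: Bij_def left_translation_def cong: bij_betw_cong)
qed

lemma (in quandle) quandle_power_quandle: "quandle (power_quandle Q I)"
proof
  fix y z assume y: "y \<in> carrier (power_quandle Q I)" and z: "z \<in> carrier (power_quandle Q I)"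
  define s where "s i = (THE x. x \<in> carrier Q \<and> y i \<triangleright> x = z i)" for i
  have s: "s i \<in> carrier Q \<and> y i \<triangleright> s i = z i" if "i \<in> I" for i
    unfolding s_def
    by (rule theI') (use y z that in \<open>auto simp: power_quandle_def intro!: tri_unique_solution\<close>)
  show "\<exists>!x. x \<in> carrier (power_quandle Q I) \<and> y \<triangleright>\<^bsub>power_quandle Q I\<^esub> x = z"
  proof (rule ex1I[of _ "restrict s I"])
    show "restrict s I \<in> carrier (power_quandle Q I) \<and> y \<triangleright>\<^bsub>power_quandle Q I\<^esub> restrict s I = z"
      using s z by (auto simp: power_quandle_def fun_eq_iff PiE_def extensional_def)
  next
    fix x assume x: "x \<in> carrier (power_quandle Q I) \<and> y \<triangleright>\<^bsub>power_quandle Q I\<^esub> x = z"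
    show "x = restrict s I"
    proof (rule extensionalityI)
      show "x \<in> extensional I" using x by (auto simp: power_quandle_def PiE_def)
      show "restrict s I \<in> extensional I" by simp
      fix i assume i: "i \<in> I"
      have "x i \<in> carrier Q" "y i \<triangleright> x i = z i" "y i \<in> carrier Q" "z i \<in> carrier Q"
        using x y z i by (auto simp: power_quandle_def)
      then show "x i = restrict s I i"
        using tri_unique_solution[of "y i" "z i"] s[OF i] i by auto
    qed
  qed
next
  fix x assume x: "x \<in> carrier (power_quandle Q I)"
  show "x \<triangleright>\<^bsub>power_quandle Q I\<^esub> x = x"
    by (rule extensionalityI[of _ I]) (use x in \<open>auto simp: power_quandle_def tri_idem PiE_iff\<close>)
qed (auto simp: power_quandle_def PiE_iff intro!: restrict_ext tri_self_distrib)

lemma (in quandle) quandle_Hom_quandle: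
  assumes "medial_quandle T"
  shows "quandle (Hom_quandle Q T)"
proof -
  interpret T: medial_quandle T by fact
  have hom: "h a \<in> carrier T" if "h \<in> quandle_hom Q T" "a \<in> carrier Q" for h a
    using that by (auto simp: quandle_hom_def)
  have homt: "h (a \<triangleright> b) = h a \<triangleright>\<^bsub>T\<^esub> h b"
    if "h \<in> quandle_hom Q T" "a \<in> carrier Q" "b \<in> carrier Q" for h a b
    using that by (auto simp: quandle_hom_def)
  show ?thesis
  proof
    fix y z assume "y \<in> carrier (Hom_quandle Q T)" "z \<in> carrier (Hom_quandle Q T)"
    then have y: "y \<in> quandle_hom Q T" and z: "z \<in> quandle_hom Q T"
      by (auto simp: Hom_quandle_def)
    define s where "s = (\<lambda>i\<in>carrier Q. THE x. x \<in> carrier T \<and> y i \<triangleright>\<^bsub>T\<^esub> x = z i)"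
    have s: "s i \<in> carrier T \<and> y i \<triangleright>\<^bsub>T\<^esub> s i = z i" if "i \<in> carrier Q" for i
    proof -
      have "(THE x. x \<in> carrier T \<and> y i \<triangleright>\<^bsub>T\<^esub> x = z i) \<in> carrier T
          \<and> y i \<triangleright>\<^bsub>T\<^esub> (THE x. x \<in> carrier T \<and> y i \<triangleright>\<^bsub>T\<^esub> x = z i) = z i"
        by (rule theI') (use y z that hom in \<open>auto intro!: T.tri_unique_solution\<close>)
      then show ?thesis using that by (simp add: s_def)
    qed
    have uniq: "u = v" if "c \<in> carrier T" "u \<in> carrier T" "v \<in> carrier T"
      "c \<triangleright>\<^bsub>T\<^esub> u = c \<triangleright>\<^bsub>T\<^esub> v" for c u v
      using T.tri_unique_solution[of c "c \<triangleright>\<^bsub>T\<^esub> v"] that by (metis T.tri_closed)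
    have "s \<in> quandle_hom Q T"
      unfolding quandle_hom_def
    proof (intro CollectI conjI ballI)
      show "s \<in> carrier Q \<rightarrow>\<^sub>E carrier T" using s by (auto simp: s_def)
      fix a b assume ab: "a \<in> carrier Q" "b \<in> carrier Q"
      note st = s[OF ab(1)] s[OF ab(2)] s[of "a \<triangleright> b"]
      have "y (a \<triangleright> b) \<triangleright>\<^bsub>T\<^esub> (s a \<triangleright>\<^bsub>T\<^esub> s b)
          = (y a \<triangleright>\<^bsub>T\<^esub> y b) \<triangleright>\<^bsub>T\<^esub> (s a \<triangleright>\<^bsub>T\<^esub> s b)"
        using homt[OF y] ab by simp
      also have "\<dots> = (y a \<triangleright>\<^bsub>T\<^esub> s a) \<triangleright>\<^bsub>T\<^esub> (y b \<triangleright>\<^bsub>T\<^esub> s b)"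
        using ab st hom[OF y] by (intro T.medial) auto
      also have "\<dots> = z (a \<triangleright> b)" using ab st homt[OF z] by simp
      finally have "y (a \<triangleright> b) \<triangleright>\<^bsub>T\<^esub> (s a \<triangleright>\<^bsub>T\<^esub> s b) = y (a \<triangleright> b) \<triangleright>\<^bsub>T\<^esub> s (a \<triangleright> b)"
        using st ab by simp
      then show "s (a \<triangleright> b) = s a \<triangleright>\<^bsub>T\<^esub> s b"
        using uniq[of "y (a \<triangleright> b)" "s (a \<triangleright> b)" "s a \<triangleright>\<^bsub>T\<^esub> s b"] st ab hom[OF y] by simp
    qed
    moreover have "y \<triangleright>\<^bsub>Hom_quandle Q T\<^esub> s = z" unfolding Hom_quandle_def quandle_struct.simps
      by (rule extensionalityI[of _ "carrier Q"]) (use s z in \<open>auto simp: quandle_hom_def PiE_def\<close>)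
    moreover have "x = s" if x0: "x \<in> carrier (Hom_quandle Q T) \<and> y \<triangleright>\<^bsub>Hom_quandle Q T\<^esub> x = z" for x
    proof (rule extensionalityI[of _ "carrier Q"])
      have x: "x \<in> quandle_hom Q T" "(\<lambda>i\<in>carrier Q. y i \<triangleright>\<^bsub>T\<^esub> x i) = z"
        using x0 by (auto simp: Hom_quandle_def)
      show "x \<in> extensional (carrier Q)" using x by (auto simp: quandle_hom_def PiE_def)
      fix i assume i: "i \<in> carrier Q"
      have "y i \<triangleright>\<^bsub>T\<^esub> x i = z i" using x(2) i by auto
      then show "x i = s i" using uniq[of "y i" "x i" "s i"] s[OF i] hom[OF x(1) i] hom[OF y i] by simp
    qed (simp add: s_def)
    moreover have "carrier (Hom_quandle Q T) = quandle_hom Q T" by (simp add: Hom_quandle_def)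
    ultimately show "\<exists>!x. x \<in> carrier (Hom_quandle Q T) \<and> y \<triangleright>\<^bsub>Hom_quandle Q T\<^esub> x = z"
      by blast
  next
    fix x y assume "x \<in> carrier (Hom_quandle Q T)" "y \<in> carrier (Hom_quandle Q T)"
    then have xy: "x \<in> quandle_hom Q T" "y \<in> quandle_hom Q T"
      by (auto simp: Hom_quandle_def)
    then have "(\<lambda>a\<in>carrier Q. x a \<triangleright>\<^bsub>T\<^esub> y a) \<in> quandle_hom Q T"
      by (auto simp: quandle_hom_def PiE_iff intro!: T.medial)
    then show "x \<triangleright>\<^bsub>Hom_quandle Q T\<^esub> y \<in> carrier (Hom_quandle Q T)"
      by (simp add: Hom_quandle_def)
  next
    fix x assume x: "x \<in> carrier (Hom_quandle Q T)"
    show "x \<triangleright>\<^bsub>Hom_quandle Q T\<^esub> x = x"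
      by (rule extensionalityI[of _ "carrier Q"])
        (use x in \<open>auto simp: Hom_quandle_def quandle_hom_def T.tri_idem PiE_iff\<close>)
  qed (auto simp: Hom_quandle_def hom intro!: restrict_ext T.tri_self_distrib)
qed

end

theory Submission
  imports Defs
begin

text \<open>In a 2-reductive medial quandle the translation by \<open>x\<close> depends only on the component of \<open>x\<close>,
  and translations commute. Hence for a homomorphism \<open>h\<close> the translation by \<open>h a\<close> depends only on
  the component of \<open>a\<close>, so \<open>h\<close> is determined by its values at one representative per component.
  Evaluation at the representatives is the embedding. Its image is stable under
  translations: applying to \<open>h\<close>, on each component of the source, a translation of \<open>T\<close> or its
  inverse yields a homomorphism again.\<close>

section \<open>Components as orbits of the translation group, and sets stable under
  translations\<close>

context quandle
begin

lemma tri_left_cancel: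
  assumes "a \<in> carrier Q" "x \<in> carrier Q" "y \<in> carrier Q"
  shows "a \<triangleright> x = a \<triangleright> y \<longleftrightarrow> x = y"
  using tri_unique_solution[of a "a \<triangleright> y"] assms by blast

text \<open>The inclusion of a generated subgroup into \<open>BijGroup (carrier Q)\<close> is a
  homomorphism, which makes the general facts on orbits available.\<close>

lemma translation_group_action: "group_action (translation_group Q) (carrier Q) (\<lambda>g. g)"
proof -
  interpret B: group "BijGroup (carrier Q)" by (rule group_BijGroup)
  have "group_hom (translation_group Q) (BijGroup (carrier Q)) (\<lambda>g. g)"
    unfolding translation_group_def group_hom_def group_hom_axioms_def
    by (intro conjI B.group_subgroup_generated B.hom_from_subgroup_generated B.is_group)
      (auto simp: hom_def)
  then show ?thesis unfolding group_action_def .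
qed

lemma left_translation_in_group:
  "a \<in> carrier Q \<Longrightarrow> left_translation Q a \<in> carrier (translation_group Q)"
  unfolding translation_group_def carrier_subgroup_generated
  by (rule generate.incl) (auto simp: BijGroup_def left_translation_Bij)

definition component_of :: "'a \<Rightarrow> 'a set"
  where "component_of x = orbit (translation_group Q) (\<lambda>g. g) x"

lemma components_eq: "components Q = component_of ` carrier Q"
  by (auto simp: components_def orbits_def component_of_def)

lemma self_in_component_of: "x \<in> carrier Q \<Longrightarrow> x \<in> component_of x"
  unfolding component_of_def
  by (rule group_action.orbit_refl[OF translation_group_action])

lemma component_of_eqI:
  assumes "x \<in> carrier Q" "y \<in> component_of x"
  shows "component_of y = component_of x"
proof -
  interpret G: group_action "translation_group Q" "carrier Q" "\<lambda>g. g"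
    by (rule translation_group_action)
  have y: "y \<in> carrier Q"
    using assms G.element_image by (auto simp: component_of_def orbit_def)
  have "component_of x \<in> components Q" "component_of y \<in> components Q"
    using assms y by (auto simp: components_eq)
  \<comment> \<open>Distinct orbits are disjoint, and \<open>y\<close> lies in both of
    these.\<close>
  then show ?thesis
    using G.disjoint_union assms(2) self_in_component_of[OF y]
    unfolding components_def by blast
qed

lemma component_of_tri:
  assumes "a \<in> carrier Q" "x \<in> carrier Q"
  shows "component_of (a \<triangleright> x) = component_of x"
proof (rule component_of_eqI[OF assms(2)])
  have "left_translation Q a x \<in> component_of x"
    using left_translation_in_group[OF assms(1)] by (auto simp: component_of_def orbit_def)
  then show "a \<triangleright> x \<in> component_of x" using assms by (simp add: left_translation_def)
qed

text \<open>Induction on the generation of \<open>g\<close>. Stability is an equivalence so that it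
  also covers inverse generators, and \<open>g x \<in> carrier Q\<close> is carried along so that
  the induction hypotheses can be chained in a product.\<close>

lemma translation_group_stable:
  assumes stable: "\<And>a x. a \<in> carrier Q \<Longrightarrow> x \<in> carrier Q \<Longrightarrow> a \<triangleright> x \<in> P \<longleftrightarrow> x \<in> P"
    and "g \<in> carrier (translation_group Q)" "x \<in> carrier Q"
  shows "g x \<in> carrier Q \<and> (g x \<in> P \<longleftrightarrow> x \<in> P)"
  using assms(2,3) unfolding translation_group_def carrier_subgroup_generated
proof (induction g arbitrary: x rule: generate.induct)
  case one
  then show ?case by (simp add: BijGroup_def)
next
  case (incl h)
  then show ?case using stable by (auto simp: left_translation_def)
next
  case (inv h)
  then obtain a where a: "a \<in> carrier Q" and h: "h = left_translation Q a" by auto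
  have hB: "h \<in> Bij (carrier Q)" using a h left_translation_Bij by simp
  \<comment> \<open>The inverse translation sends \<open>x\<close> to this \<open>y\<close>, so
    stability at \<open>y\<close> is read backwards.\<close>
  obtain y where y: "y \<in> carrier Q" "a \<triangleright> y = x" using tri_unique_solution[OF a inv.prems] by blast
  have "inv_into (carrier Q) h x = y"
    using hB y by (auto simp: h left_translation_def Bij_def bij_betw_def intro!: inv_into_f_eq)
  then show ?case using hB y inv.prems stable[OF a y(1)] by (simp add: inv_BijGroup)
next
  case (eng h1 h2)
  \<comment> \<open>The product of \<open>BijGroup\<close> is defined as composition only on
    \<open>Bij\<close>, so both factors must be shown to lie there.\<close>
  have "h \<in> Bij (carrier Q)"
    if "h \<in> generate (BijGroup (carrier Q))
          (carrier (BijGroup (carrier Q)) \<inter> left_translation Q ` carrier Q)" for h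
    using group.generate_in_carrier[OF group_BijGroup _ that] by (auto simp: BijGroup_def)
  from this[OF eng.hyps(1)] this[OF eng.hyps(2)]
  have "(h1 \<otimes>\<^bsub>BijGroup (carrier Q)\<^esub> h2) x = h1 (h2 x)"
    using eng.prems by (simp add: BijGroup_def compose_def)
  then show ?case using eng.IH eng.prems by metis
qed

text \<open>This serves as an induction principle: a property spreads over a whole component once
  single translations preserve and reflect it.\<close>

lemma component_of_stable:
  assumes "\<And>a x. a \<in> carrier Q \<Longrightarrow> x \<in> carrier Q \<Longrightarrow> a \<triangleright> x \<in> P \<longleftrightarrow> x \<in> P"
    and "x \<in> carrier Q" "y \<in> component_of x"
  shows "y \<in> carrier Q \<and> (y \<in> P \<longleftrightarrow> x \<in> P)"
proof -
  obtain g where "g \<in> carrier (translation_group Q)" "y = g x"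
    using assms(3) by (auto simp: component_of_def orbit_def)
  then show ?thesis using translation_group_stable[of P, OF assms(1) _ assms(2)] by simp
qed

lemma stable_Union_components:
  assumes "P \<subseteq> carrier Q"
    and "\<And>a x. a \<in> carrier Q \<Longrightarrow> x \<in> carrier Q \<Longrightarrow> a \<triangleright> x \<in> P \<longleftrightarrow> x \<in> P"
  shows "P = \<Union> (component_of ` P)"
proof (intro equalityI subsetI)
  show "x \<in> \<Union> (component_of ` P)" if "x \<in> P" for x
    using assms(1) self_in_component_of[of x] that by blast
next
  fix y assume "y \<in> \<Union> (component_of ` P)"
  then obtain x where "x \<in> P" "y \<in> component_of x" by blast
  then show "y \<in> P" using component_of_stable[of P, OF assms(2)] assms(1) by blast
qed

definition representative :: "'a set \<Rightarrow> 'a"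
  where "representative C = (SOME x. x \<in> C)"

lemma representative_in:
  assumes "C \<in> components Q"
  shows "representative C \<in> C"
proof -
  have "\<exists>x. x \<in> C" using assms self_in_component_of by (auto simp: components_eq)
  then show ?thesis unfolding representative_def by (rule someI_ex)
qed

lemma component_representative:
  assumes "C \<in> components Q"
  shows "representative C \<in> carrier Q" "component_of (representative C) = C"
proof -
  obtain x where x: "x \<in> carrier Q" "C = component_of x" using assms by (auto simp: components_eq)
  then have "representative C \<in> component_of x" using representative_in[OF assms] by simp
  \<comment> \<open>For \<open>UNIV\<close> stability is trivial, and only membership in the carrier
    remains.\<close>
  from component_of_stable[of UNIV, OF _ x(1) this] component_of_eqI[OF x(1) this] x(2)
  show "representative C \<in> carrier Q" "component_of (representative C) = C" by simp_all
qed

end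

section \<open>Translations and homomorphisms in the 2-reductive case\<close>

lemma (in two_reductive_medial_quandle) translations_commute:
  assumes "x \<in> carrier Q" "y \<in> carrier Q" "z \<in> carrier Q"
  shows "x \<triangleright> (y \<triangleright> z) = y \<triangleright> (x \<triangleright> z)"
proof -
  \<comment> \<open>2-reductivity read from right to left brings the term into the shape of
    self-distributivity.\<close>
  have "x \<triangleright> (y \<triangleright> z) = (y \<triangleright> x) \<triangleright> (y \<triangleright> z)" using assms by (simp add: two_reductive)
  also have "\<dots> = y \<triangleright> (x \<triangleright> z)" using assms by (simp only: tri_self_distrib)
  finally show ?thesis .
qed

locale two_reductive_target = S: quandle S + T: two_reductive_medial_quandle T
  for S :: "('a, 'c) quandle_struct_scheme" and T :: "('b, 'd) quandle_struct_scheme"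
begin

lemma hom_closed: "h \<in> quandle_hom S T \<Longrightarrow> a \<in> carrier S \<Longrightarrow> h a \<in> carrier T"
  by (auto simp: quandle_hom_def)

lemma hom_tri:
  "h \<in> quandle_hom S T \<Longrightarrow> a \<in> carrier S \<Longrightarrow> b \<in> carrier S
    \<Longrightarrow> h (a \<triangleright>\<^bsub>S\<^esub> b) = h a \<triangleright>\<^bsub>T\<^esub> h b"
  by (auto simp: quandle_hom_def)

text \<open>By 2-reductivity \<open>h (c \<triangleright> x) = h c \<triangleright> h x\<close>
  translates \<open>t\<close> exactly as \<open>h x\<close> does, so the set of \<open>x\<close>
  whose image translates \<open>t\<close> as \<open>h b\<close> does is stable.\<close>

lemma hom_translation_cong:
  assumes h: "h \<in> quandle_hom S T" and a: "a \<in> carrier S" "b \<in> carrier S"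
    and "S.component_of a = S.component_of b" "t \<in> carrier T"
  shows "h a \<triangleright>\<^bsub>T\<^esub> t = h b \<triangleright>\<^bsub>T\<^esub> t"
  using S.component_of_stable[of "{x. h x \<triangleright>\<^bsub>T\<^esub> t = h b \<triangleright>\<^bsub>T\<^esub> t}" a b]
    assms S.self_in_component_of[of b]
  by (auto simp: hom_tri[OF h] hom_closed[OF h] T.two_reductive)

section \<open>Evaluation at one representative per component\<close>

definition eval_reps :: "('a \<Rightarrow> 'b) \<Rightarrow> 'a set \<Rightarrow> 'b"
  where "eval_reps h = (\<lambda>C\<in>components S. h (S.representative C))"

lemma eval_reps_closed: "h \<in> quandle_hom S T \<Longrightarrow> eval_reps h \<in> components S \<rightarrow>\<^sub>E carrier T"
  by (auto simp: eval_reps_def hom_closed S.component_representative)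

lemma eval_reps_hom:
  "eval_reps \<in> carrier (Hom_quandle S T) \<rightarrow> carrier (power_quandle T (components S))"
  "h \<in> quandle_hom S T \<Longrightarrow> k \<in> quandle_hom S T \<Longrightarrow>
    eval_reps (h \<triangleright>\<^bsub>Hom_quandle S T\<^esub> k)
      = eval_reps h \<triangleright>\<^bsub>power_quandle T (components S)\<^esub> eval_reps k"
  using eval_reps_closed
  by (auto simp: Hom_quandle_def power_quandle_def eval_reps_def S.component_representative)

text \<open>The set on which \<open>h\<close> and \<open>k\<close> agree is stable under
  translations and meets every component in its representative.\<close>

lemma eval_reps_inj: "inj_on eval_reps (quandle_hom S T)"
proof (rule inj_onI)
  fix h k assume h: "h \<in> quandle_hom S T" and k: "k \<in> quandle_hom S T"
    and eq: "eval_reps h = eval_reps k"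
  have reps: "h (S.representative C) = k (S.representative C)" if "C \<in> components S" for C
    using fun_cong[OF eq, of C] that by (simp add: eval_reps_def)
  have "h x = k x" if x: "x \<in> carrier S" for x
  proof -
    have "h (a \<triangleright>\<^bsub>S\<^esub> y) = k (a \<triangleright>\<^bsub>S\<^esub> y) \<longleftrightarrow> h y = k y"
      if ay: "a \<in> carrier S" "y \<in> carrier S" for a y
    proof -
      let ?r = "S.representative (S.component_of a)"
      have C: "S.component_of a \<in> components S" using ay by (simp add: S.components_eq)
      note r = S.component_representative[OF C]
      \<comment> \<open>Translations by \<open>h a\<close> and by \<open>k a\<close> coincide, since
        \<open>h\<close> and \<open>k\<close> agree at \<open>?r\<close>; the common translation can
        then be cancelled.\<close>
      have "h (a \<triangleright>\<^bsub>S\<^esub> y) = h ?r \<triangleright>\<^bsub>T\<^esub> h y" "k (a \<triangleright>\<^bsub>S\<^esub> y) = h ?r \<triangleright>\<^bsub>T\<^esub> k y"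
        using h k ay r reps[OF C] hom_translation_cong[of _ a ?r] by (simp_all add: hom_tri hom_closed)
      then show ?thesis using h k ay r by (simp add: T.tri_left_cancel hom_closed)
    qed
    moreover have C: "S.component_of x \<in> components S" using x by (simp add: S.components_eq)
    ultimately show ?thesis
      using S.component_of_stable[of "{y. h y = k y}" x] x reps[OF C] S.representative_in[OF C]
      by auto
  qed
  then show "h = k"
    using h k by (intro extensionalityI[of _ "carrier S"]) (auto simp: quandle_hom_def PiE_def)
qed

section \<open>Stability of the image under translations of the power and their inverses\<close>

lemma tri_in_eval_reps_image:
  assumes g: "g \<in> components S \<rightarrow>\<^sub>E carrier T" and h: "h \<in> quandle_hom S T"
  shows "(\<lambda>C\<in>components S. g C \<triangleright>\<^bsub>T\<^esub> eval_reps h C) \<in> eval_reps ` quandle_hom S T"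
proof
  define k where "k = (\<lambda>a\<in>carrier S. g (S.component_of a) \<triangleright>\<^bsub>T\<^esub> h a)"
  have gc: "g (S.component_of a) \<in> carrier T" if "a \<in> carrier S" for a
    using g that by (auto simp: S.components_eq)
  show "(\<lambda>C\<in>components S. g C \<triangleright>\<^bsub>T\<^esub> eval_reps h C) = eval_reps k"
    by (auto simp: eval_reps_def k_def S.component_representative)
  \<comment> \<open>In \<open>k a \<triangleright> k b\<close> the factor at the component of
    \<open>a\<close> is absorbed by 2-reductivity. The one at the component of \<open>b\<close>,
    which also contains \<open>a \<triangleright> b\<close>, commutes past
    \<open>h a\<close>.\<close>
  have "k (a \<triangleright>\<^bsub>S\<^esub> b) = k a \<triangleright>\<^bsub>T\<^esub> k b" if "a \<in> carrier S" "b \<in> carrier S" for a b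
    using that gc h
    by (simp add: k_def hom_tri hom_closed S.component_of_tri T.two_reductive
        T.translations_commute[of "h a" "g (S.component_of b)"])
  then show "k \<in> quandle_hom S T"
    using gc h by (auto simp: quandle_hom_def k_def)
qed

text \<open>Dividing \<open>h\<close> by \<open>g\<close> along each component gives a homomorphism
  \<open>k\<close>, and \<open>f\<close> must be its evaluation because translations are
  injective.\<close>

lemma untri_in_eval_reps_image:
  assumes g: "g \<in> components S \<rightarrow>\<^sub>E carrier T" and f: "f \<in> components S \<rightarrow>\<^sub>E carrier T"
    and h: "h \<in> quandle_hom S T"
    and eq: "(\<lambda>C\<in>components S. g C \<triangleright>\<^bsub>T\<^esub> f C) = eval_reps h"
  shows "f \<in> eval_reps ` quandle_hom S T"
proof -
  have gc: "g (S.component_of a) \<in> carrier T" if "a \<in> carrier S" for a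
    using g that by (auto simp: S.components_eq)
  have "\<exists>x. x \<in> carrier T \<and> g (S.component_of a) \<triangleright>\<^bsub>T\<^esub> x = h a" if "a \<in> carrier S" for a
    using T.tri_unique_solution[OF gc hom_closed[OF h]] that by blast
  then obtain k0 where k0: "\<And>a. a \<in> carrier S \<Longrightarrow>
      k0 a \<in> carrier T \<and> g (S.component_of a) \<triangleright>\<^bsub>T\<^esub> k0 a = h a"
    by metis
  define k where "k = restrict k0 (carrier S)"
  have kc: "k a \<in> carrier T" and gk: "g (S.component_of a) \<triangleright>\<^bsub>T\<^esub> k a = h a"
    if "a \<in> carrier S" for a
    using k0 that by (auto simp: k_def)
  have "k (a \<triangleright>\<^bsub>S\<^esub> b) = k a \<triangleright>\<^bsub>T\<^esub> k b" if ab: "a \<in> carrier S" "b \<in> carrier S" for a b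
  proof -
    let ?c = "g (S.component_of b)"
    \<comment> \<open>Both sides are compared after translating by \<open>?c\<close>, which is
      injective; \<open>?c\<close> is also the value of \<open>g\<close> at the component of
      \<open>a \<triangleright> b\<close>.\<close>
    have "?c \<triangleright>\<^bsub>T\<^esub> k (a \<triangleright>\<^bsub>S\<^esub> b) = h a \<triangleright>\<^bsub>T\<^esub> h b"
      using gk[of "a \<triangleright>\<^bsub>S\<^esub> b"] ab h by (simp add: S.component_of_tri hom_tri)
    also have "\<dots> = (g (S.component_of a) \<triangleright>\<^bsub>T\<^esub> k a) \<triangleright>\<^bsub>T\<^esub> (?c \<triangleright>\<^bsub>T\<^esub> k b)"
      using gk ab by simp
    also have "\<dots> = k a \<triangleright>\<^bsub>T\<^esub> (?c \<triangleright>\<^bsub>T\<^esub> k b)"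
      using ab gc kc by (simp only: T.two_reductive T.tri_closed)
    also have "\<dots> = ?c \<triangleright>\<^bsub>T\<^esub> (k a \<triangleright>\<^bsub>T\<^esub> k b)"
      using ab gc kc by (intro T.translations_commute) auto
    finally show ?thesis using ab gc kc by (simp add: T.tri_left_cancel)
  qed
  then have "k \<in> quandle_hom S T" using kc by (auto simp: quandle_hom_def k_def)
  moreover have "f = eval_reps k"
  proof (rule extensionalityI[of _ "components S"])
    fix C assume C: "C \<in> components S"
    note r = S.component_representative[OF C]
    have "g C \<triangleright>\<^bsub>T\<^esub> f C = g C \<triangleright>\<^bsub>T\<^esub> k (S.representative C)"
      using fun_cong[OF eq, of C] C gk[OF r(1)] r(2) by (simp add: eval_reps_def)
    then show "f C = eval_reps k C"
      using C f g kc[OF r(1)] T.tri_left_cancel[of "g C" "f C"] by (auto simp: eval_reps_def)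
  qed (use f in \<open>auto simp: eval_reps_def PiE_def\<close>)
  ultimately show ?thesis by blast
qed

end

section \<open>The embedding and the components that make up its image\<close>

theorem corollary3p26:
  fixes S :: "('a, 'c) quandle_struct_scheme" and T :: "('b, 'd) quandle_struct_scheme"
  assumes "quandle S" and "two_reductive_medial_quandle T"
  shows "\<exists>\<phi> \<in> quandle_hom (Hom_quandle S T) (power_quandle T (components S)).
           inj_on \<phi> (carrier (Hom_quandle S T)) \<and>
           (\<exists>X \<subseteq> components (power_quandle T (components S)).
              \<phi> ` carrier (Hom_quandle S T) = \<Union>X)"
proof -
  interpret two_reductive_target S T
    using assms by (simp add: two_reductive_target_def)
  interpret H: quandle "Hom_quandle S T"
    by (rule S.quandle_Hom_quandle) (rule T.medial_quandle_axioms)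
  interpret P: quandle "power_quandle T (components S)"
    by (rule T.quandle_power_quandle)
  let ?H = "Hom_quandle S T" and ?P = "power_quandle T (components S)"
  \<comment> \<open>The restriction is needed because \<open>quandle_hom\<close> contains only
    extensional maps.\<close>
  let ?\<phi> = "restrict eval_reps (carrier ?H)" and ?I = "eval_reps ` quandle_hom S T"
  have H: "carrier ?H = quandle_hom S T" by (simp add: Hom_quandle_def)
  have "?\<phi> \<in> quandle_hom ?H ?P"
    using eval_reps_hom H.tri_closed by (auto simp: quandle_hom_def[of ?H ?P] H)
  moreover have "inj_on ?\<phi> (carrier ?H)"
    using eval_reps_inj by (simp add: H inj_on_restrict_eq)
  moreover have "\<exists>X \<subseteq> components ?P. ?\<phi> ` carrier ?H = \<Union>X"
  proof (intro exI conjI)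
    have sub: "?I \<subseteq> carrier ?P" using eval_reps_closed by (auto simp: power_quandle_def)
    show "P.component_of ` ?I \<subseteq> components ?P" using sub by (auto simp: P.components_eq)
    have stable: "g \<triangleright>\<^bsub>?P\<^esub> f \<in> ?I \<longleftrightarrow> f \<in> ?I" if "g \<in> carrier ?P" "f \<in> carrier ?P" for g f
      using that tri_in_eval_reps_image untri_in_eval_reps_image
      by (auto simp: power_quandle_def)
    have "?\<phi> ` carrier ?H = ?I" by (simp add: H)
    also have "\<dots> = \<Union> (P.component_of ` ?I)"
      by (rule P.stable_Union_components[OF sub stable])
    finally show "?\<phi> ` carrier ?H = \<Union> (P.component_of ` ?I)" .
  qed
  ultimately show ?thesis by blast
qed

end
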